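(* Let $\nu\in\{0,1\}$, let $N$ be a non-negative integer and $M$ an integer such that $2N+\nu$ and $M$ are positive, let $a,b,c,d$ be variables and $Q=abcd$. Then \begin{align*} \Phi_{2N+\nu,2M}(a,b,c,d) &= \sum_{l=0}^N \genfrac{[}{]}{0pt}{}{N-l+M-1}{N-l}_{Q} (ab)^{N-l} \sum_{m_2=0}^l (abc)^{m_2} Q^{\binom{m_2}{2}} \genfrac{[}{]}{0pt}{}{l}{m_2}_{Q} \sum_{m_1=0}^{l+\nu} a^{m_1} Q^{\binom{m_1}{2}} \genfrac{[}{]}{0pt}{}{l+\nu}{m_1}_{Q}\\ &\qquad\times \sum_{n=0}^{M-m_1-m_2} \genfrac{[}{]}{0pt}{}{M+l-n-m_1-m_2}{M-n-m_1-m_2}_{Q} \frac{(Q^{l+\nu};Q)_n}{(Q;Q)_n} (ac)^n, \end{align*} where the innermost sum is $0$ if $m_1+m_2>M$.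
   Context: A partition $\pi=(\lambda_1,\lambda_2,\dots)$ is a finite non-increasing sequence of positive integers (its parts); the empty sequence is the unique partition of $0$. Decorate the Ferrers diagram of $\pi$ (row $r$ has $\lambda_r$ boxes) as follows: boxes in the odd-indexed rows $\lambda_1,\lambda_3,\dots$ are filled alternately with $a,b,a,b,\dots$ starting from $a$, and boxes in the even-indexed rows $\lambda_2,\lambda_4,\dots$ are filled alternately with $c,d,c,d,\dots$ starting from $c$. The weight is $\omega_\pi(a,b,c,d)=a^{\#a}b^{\#b}c^{\#c}d^{\#d}$, where $\#a$ is the number of boxes filled with $a$, etc. $\Phi_{N,M}(a,b,c,d)=\sum_\pi\omega_\pi(a,b,c,d)$, the sum being over all partitions $\pi$ with every part $\le N$ and with at most $M$ parts. Notation: $(x;q)_L=\prod_{n=0}^{L-1}(1-xq^n)$; $\genfrac{[}{]}{0pt}{}{m}{n}_q=\frac{(q;q)_m}{(q;q)_n(q;q)_{m-n}}$ for $m\ge n\ge0$ and $0$ otherwise. *)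

theory Defs
  imports Main
begin

text \<open>Partitions are lists of positive integers in non-increasing order; the part
  \<open>\<lambda>\<^sub>r\<close> is \<open>\<pi> ! (r - 1)\<close>, and the boxes of the diagram are numbered from \<open>(1, 1)\<close>.\<close>

definition is_partition :: "nat list \<Rightarrow> bool" where
  "is_partition \<pi> \<longleftrightarrow> sorted_wrt (\<ge>) \<pi> \<and> (\<forall>p\<in>set \<pi>. 0 < p)"

definition diagram :: "nat list \<Rightarrow> (nat \<times> nat) set" where
  "diagram \<pi> = {(r, s). 1 \<le> r \<and> r \<le> length \<pi> \<and> 1 \<le> s \<and> s \<le> \<pi> ! (r - 1)}"

datatype letter = Letter_a | Letter_b | Letter_c | Letter_d

fun filling :: "nat \<times> nat \<Rightarrow> letter" where
  "filling (r, s) =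
     (if odd r then (if odd s then Letter_a else Letter_b)
      else (if odd s then Letter_c else Letter_d))"

definition num_boxes :: "letter \<Rightarrow> nat list \<Rightarrow> nat" where
  "num_boxes x \<pi> = card {p \<in> diagram \<pi>. filling p = x}"

definition weight :: "nat list \<Rightarrow> 'a::comm_ring_1 \<Rightarrow> 'a \<Rightarrow> 'a \<Rightarrow> 'a \<Rightarrow> 'a" where
  "weight \<pi> a b c d =
     a ^ num_boxes Letter_a \<pi> * b ^ num_boxes Letter_b \<pi> *
     c ^ num_boxes Letter_c \<pi> * d ^ num_boxes Letter_d \<pi>"

definition bounded_partitions :: "nat \<Rightarrow> nat \<Rightarrow> nat list set" where
  "bounded_partitions N M = {\<pi>. is_partition \<pi> \<and> (\<forall>p\<in>set \<pi>. p \<le> N) \<and> length \<pi> \<le> M}"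

lemma finite_bounded_partitions: "finite (bounded_partitions N M)"
  by (rule finite_subset[OF _ finite_lists_length_le[of "{..N}" M]])
     (auto simp: bounded_partitions_def)

definition Phi :: "nat \<Rightarrow> nat \<Rightarrow> 'a::comm_ring_1 \<Rightarrow> 'a \<Rightarrow> 'a \<Rightarrow> 'a \<Rightarrow> 'a" where
  "Phi N M a b c d = (\<Sum>\<pi>\<in>bounded_partitions N M. weight \<pi> a b c d)"

definition qpoch :: "'a::comm_ring_1 \<Rightarrow> 'a \<Rightarrow> nat \<Rightarrow> 'a" where
  "qpoch x q L = (\<Prod>n<L. 1 - x * q ^ n)"

definition qbinom :: "'a::field \<Rightarrow> nat \<Rightarrow> nat \<Rightarrow> 'a" where
  "qbinom q m n = (if n \<le> m then qpoch q q m / (qpoch q q n * qpoch q q (m - n)) else 0)"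

end

theory Submission
  imports Defs "HOL-Computational_Algebra.Formal_Power_Series"
begin

text \<open>Read a partition with at most \<open>2 * M\<close> parts as a chain of \<open>M\<close> row pairs \<open>(x, y)\<close>, \<open>x \<ge> y\<close>.
  Two adjacent equal columns can be removed without changing the filling of the others.
  Removing them from the columns of height \<open>2 * k + 1\<close>, \<open>k < M\<close>, where each such pair has weight
  \<open>a * b * Q ^ k\<close>, leaves row pairs with \<open>x - y \<le> 1\<close> and yields the outer sum over \<open>l\<close>. In a chain
  of such row pairs each \<open>(y, y)\<close> may repeat, each \<open>(y + 1, y)\<close> occurs at most once, and the chain
  is determined by these multiplicities, so the generating function in \<open>M\<close> is a product, whose four
  factors come from the pairs of weight \<open>Q ^ t\<close>, \<open>a * c * Q ^ t\<close>, \<open>a * Q ^ t\<close> and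
  \<open>a * b * c * Q ^ t\<close>. The q-binomial theorem expands it into the inner sums.\<close>

subsection \<open>Splitting off the first two rows\<close>

definition pair_weight :: "'a::comm_ring_1 \<Rightarrow> 'a \<Rightarrow> 'a \<Rightarrow> 'a \<Rightarrow> nat \<Rightarrow> nat \<Rightarrow> 'a" where
  "pair_weight a b c d x y =
     a ^ ((x + 1) div 2) * b ^ (x div 2) * c ^ ((y + 1) div 2) * d ^ (y div 2)"

lemma card_parity_atMost:
  "card {s. Suc 0 \<le> s \<and> s \<le> x \<and> odd s} = (x + 1) div 2 \<and>
   card {s. Suc 0 \<le> s \<and> s \<le> x \<and> even s} = x div 2"
proof (induction x)
  case 0
  have "{s. Suc 0 \<le> s \<and> s \<le> 0 \<and> P s} = {}" for P
    by auto
  then show ?case by simp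
next
  case (Suc x)
  have ins: "{s. Suc 0 \<le> s \<and> s \<le> Suc x \<and> P s} =
      (if P (Suc x) then insert (Suc x) {s. Suc 0 \<le> s \<and> s \<le> x \<and> P s}
       else {s. Suc 0 \<le> s \<and> s \<le> x \<and> P s})" for P
    by (auto simp: le_Suc_eq)
  have fin: "finite {s. Suc 0 \<le> s \<and> s \<le> x \<and> P s}" for P
    by (rule finite_subset[of _ "{..x}"]) auto
  show ?case
    using Suc.IH unfolding ins by (auto simp: fin card_insert_if)
qed

lemma card_row_filling:
  "card {s. Suc 0 \<le> s \<and> s \<le> x \<and> filling (r, s) = z} =
    (if z = (if odd r then Letter_a else Letter_c) then (x + 1) div 2
     else if z = (if odd r then Letter_b else Letter_d) then x div 2 else 0)"
proof -
  have "{s. Suc 0 \<le> s \<and> s \<le> x \<and> filling (r, s) = z} =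
    (if z = (if odd r then Letter_a else Letter_c) then {s. Suc 0 \<le> s \<and> s \<le> x \<and> odd s}
     else if z = (if odd r then Letter_b else Letter_d) then {s. Suc 0 \<le> s \<and> s \<le> x \<and> even s}
     else {})"
    by (cases "odd r") (auto split: if_splits)
  then show ?thesis
    by (simp add: card_parity_atMost del: filling.simps)
qed

lemma num_boxes_eq_sum:
  "num_boxes z \<pi> =
    (\<Sum>i<length \<pi>. card {s. Suc 0 \<le> s \<and> s \<le> \<pi> ! i \<and> filling (Suc i, s) = z})"
proof -
  have "bij_betw (\<lambda>(i, s). (Suc i, s))
      (SIGMA i:{..<length \<pi>}. {s. Suc 0 \<le> s \<and> s \<le> \<pi> ! i \<and> filling (Suc i, s) = z})
      {p \<in> diagram \<pi>. filling p = z}"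
    by (rule bij_betw_byWitness[where f' = "\<lambda>(r, s). (r - 1, s)"]) (auto simp: diagram_def)
  then have "num_boxes z \<pi> =
      card (SIGMA i:{..<length \<pi>}. {s. Suc 0 \<le> s \<and> s \<le> \<pi> ! i \<and> filling (Suc i, s) = z})"
    by (simp add: num_boxes_def bij_betw_same_card)
  also have "\<dots> = (\<Sum>i<length \<pi>. card {s. Suc 0 \<le> s \<and> s \<le> \<pi> ! i \<and> filling (Suc i, s) = z})"
    by (rule card_SigmaI) (auto intro: finite_subset[where B = "{..\<pi> ! i}" for i])
  finally show ?thesis .
qed

text \<open>Deleting two rows preserves the parity of the remaining row indices, hence their
  filling.\<close>

lemma num_boxes_Cons_Cons:
  "num_boxes z (x # y # \<pi>) = card {s. Suc 0 \<le> s \<and> s \<le> x \<and> filling (1, s) = z} +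
     card {s. Suc 0 \<le> s \<and> s \<le> y \<and> filling (2, s) = z} + num_boxes z \<pi>"
  by (simp add: num_boxes_eq_sum sum.lessThan_Suc_shift del: sum.lessThan_Suc)

lemma weight_Cons_Cons:
  "weight (x # y # \<pi>) a b c d = pair_weight a b c d x y * weight \<pi> a b c d"
  unfolding weight_def num_boxes_Cons_Cons card_row_filling
  by (simp add: pair_weight_def power_add mult_ac)

text \<open>An empty row has no boxes; this lets a single part \<open>x\<close> count as the row
  pair \<open>(x, 0)\<close>.\<close>

lemma weight_pad_zero: "weight (\<pi> @ [0]) a b c d = weight \<pi> a b c d"
proof -
  have "diagram (\<pi> @ [0]) = diagram \<pi>"
    by (auto simp: diagram_def nth_append split: if_splits)
  then show ?thesis by (simp add: weight_def num_boxes_def)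
qed

lemma weight_Nil: "weight [] a b c d = 1"
  by (simp add: weight_def num_boxes_eq_sum)

lemma bounded_partitions_0: "bounded_partitions 0 M = {[]}"
proof -
  have "\<pi> = []" if "\<forall>p\<in>set \<pi>. 0 < p" "\<forall>p\<in>set \<pi>. p \<le> 0" for \<pi> :: "nat list"
    using that by (cases \<pi>) auto
  then show ?thesis
    by (auto simp: bounded_partitions_def is_partition_def)
qed

lemma Phi_0_right: "Phi K 0 a b c d = 1"
proof -
  have "bounded_partitions K 0 = {[]}"
    by (auto simp: bounded_partitions_def is_partition_def)
  then show ?thesis by (simp add: Phi_def weight_Nil)
qed

lemma bounded_partitions_Cons_Cons:
  "x # y # \<pi> \<in> bounded_partitions K (Suc (Suc M)) \<longleftrightarrow>
     0 < y \<and> y \<le> x \<and> x \<le> K \<and> \<pi> \<in> bounded_partitions y M"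
  by (auto simp: bounded_partitions_def is_partition_def)

text \<open>Sort the partitions by their first two parts, a missing part counting as 0: the
  remaining parts are bounded by \<open>y\<close>.\<close>

lemma Phi_split_first_rows:
  "Phi K (Suc (Suc M)) a b c d =
     (\<Sum>x\<le>K. \<Sum>y\<le>x. pair_weight a b c d x y * Phi y M a b c d)"
proof -
  \<comment> \<open>Padding zeros are dropped, since parts are positive; \<open>y = 0\<close> forces
    an empty tail, so \<open>g\<close> recovers the triple.\<close>
  define f where "f = (\<lambda>(x::nat, y::nat, \<pi>). if x = 0 then [] else if y = 0 then [x] else x # y # \<pi>)"
  define g where "g = (\<lambda>\<pi>::nat list. case \<pi> of [] \<Rightarrow> (0, 0, []) | [x] \<Rightarrow> (x, 0, []) | x # y # \<pi> \<Rightarrow> (x, y, \<pi>))"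
  let ?A = "SIGMA x:{..K}. SIGMA y:{..x}. bounded_partitions y M"
  have w: "weight (f (x, y, \<pi>)) a b c d = pair_weight a b c d x y * weight \<pi> a b c d"
    if "(x, y, \<pi>) \<in> ?A" for x y \<pi>
  proof (cases "y = 0")
    case True
    then have "\<pi> = []" using that by (simp add: bounded_partitions_0)
    moreover have "weight [x] a b c d = pair_weight a b c d x 0"
      using weight_pad_zero[of "[x]" a b c d] by (simp add: weight_Cons_Cons weight_Nil)
    moreover have "pair_weight a b c d 0 0 = 1" by (simp add: pair_weight_def)
    ultimately show ?thesis using True by (simp add: f_def weight_Nil)
  next
    case False
    then show ?thesis using that by (auto simp: f_def weight_Cons_Cons)
  qed
  have "Phi K (Suc (Suc M)) a b c d = (\<Sum>p\<in>?A. weight (f p) a b c d)"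
    unfolding Phi_def
  proof (rule sum.reindex_bij_witness[where i = f and j = g])
    fix \<pi> assume \<pi>: "\<pi> \<in> bounded_partitions K (Suc (Suc M))"
    consider "\<pi> = []" | x where "\<pi> = [x]" | x y \<pi>' where "\<pi> = x # y # \<pi>'"
      by (metis list.exhaust)
    then have "f (g \<pi>) = \<pi> \<and> g \<pi> \<in> ?A"
    proof cases
      case 3
      then show ?thesis using \<pi> by (auto simp: f_def g_def bounded_partitions_Cons_Cons)
    qed (use \<pi> in \<open>auto simp: f_def g_def bounded_partitions_0, auto simp: bounded_partitions_def is_partition_def\<close>)
    then show "f (g \<pi>) = \<pi>" "g \<pi> \<in> ?A" "weight (f (g \<pi>)) a b c d = weight \<pi> a b c d"
      by auto
  next
    fix p assume p: "p \<in> ?A"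
    obtain x y \<pi> where p_eq: "p = (x, y, \<pi>)" by (cases p)
    show "g (f p) = p"
      using p by (auto simp: p_eq f_def g_def bounded_partitions_0)
    have "[] \<in> bounded_partitions K (Suc (Suc M))" "0 < x \<Longrightarrow> x \<le> K \<Longrightarrow> [x] \<in> bounded_partitions K (Suc (Suc M))"
      by (auto simp: bounded_partitions_def is_partition_def)
    then show "f p \<in> bounded_partitions K (Suc (Suc M))"
      using p by (auto simp: p_eq f_def bounded_partitions_Cons_Cons)
  qed
  also have "\<dots> = (\<Sum>(x, y, \<pi>)\<in>?A. pair_weight a b c d x y * weight \<pi> a b c d)"
    by (rule sum.cong) (use w in auto)
  also have "\<dots> = (\<Sum>x\<le>K. \<Sum>y\<le>x. pair_weight a b c d x y * Phi y M a b c d)"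
    by (simp add: sum.Sigma[symmetric] finite_bounded_partitions Phi_def sum_distrib_left)
  finally show ?thesis .
qed

subsection \<open>Removing repeated columns of odd height\<close>

text \<open>Adds one row pair on top: applied to \<open>\<lambda>y. Phi y (2 * M) a b c d\<close> it
  gives \<open>Phi K (2 * Suc M) a b c d\<close>.\<close>

definition row_pairs :: "'a::comm_ring_1 \<Rightarrow> 'a \<Rightarrow> 'a \<Rightarrow> 'a \<Rightarrow> (nat \<Rightarrow> 'a) \<Rightarrow> nat \<Rightarrow> 'a" where
  "row_pairs a b c d f K = (\<Sum>x\<le>K. \<Sum>y\<le>x. pair_weight a b c d x y * f y)"

text \<open>The part of \<^const>\<open>row_pairs\<close> with \<open>x - y \<le> 1\<close>.\<close>

primrec close_row_pairs :: "'a::comm_ring_1 \<Rightarrow> 'a \<Rightarrow> 'a \<Rightarrow> 'a \<Rightarrow> (nat \<Rightarrow> 'a) \<Rightarrow> nat \<Rightarrow> 'a" where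
  "close_row_pairs a b c d f 0 = f 0"
| "close_row_pairs a b c d f (Suc K) = close_row_pairs a b c d f K +
     pair_weight a b c d (Suc K) (Suc K) * f (Suc K) + pair_weight a b c d (Suc K) K * f K"

text \<open>Generating function of chains of \<open>M\<close> row pairs with entries at most
  \<open>K\<close> and \<open>x - y \<le> 1\<close> in each pair; pairs \<open>(0, 0)\<close> are
  allowed.\<close>

definition close_gf :: "'a::comm_ring_1 \<Rightarrow> 'a \<Rightarrow> 'a \<Rightarrow> 'a \<Rightarrow> nat \<Rightarrow> nat \<Rightarrow> 'a" where
  "close_gf a b c d M = (close_row_pairs a b c d ^^ M) (\<lambda>_. 1)"

lemma close_gf_0 [simp]: "close_gf a b c d 0 K = 1"
  by (simp add: close_gf_def)

lemma close_gf_Suc: "close_gf a b c d (Suc M) = close_row_pairs a b c d (close_gf a b c d M)"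
  by (simp add: close_gf_def)

lemma close_gf_0_right [simp]: "close_gf a b c d M 0 = 1"
  by (induction M) (simp_all add: close_gf_Suc)

lemma pair_weight_add_left:
  "pair_weight a b c d (Suc (Suc x)) y = a * b * pair_weight a b c d x y"
  by (simp add: pair_weight_def mult_ac)

text \<open>Two adjacent columns meet a row pair in one box of each letter.\<close>

lemma pair_weight_add_both:
  "pair_weight a b c d (x + 2 * j) (y + 2 * j) = (a * b * c * d) ^ j * pair_weight a b c d x y"
proof -
  have "(x + 2 * j + 1) div 2 = (x + 1) div 2 + j" for x by presburger
  then show ?thesis
    by (simp add: pair_weight_def power_add power_mult_distrib mult_ac)
qed

lemma row_pairs_Suc:
  "row_pairs a b c d f (Suc K) =
     row_pairs a b c d f K + (\<Sum>y\<le>Suc K. pair_weight a b c d (Suc K) y * f y)"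
  by (simp add: row_pairs_def)

lemma row_pairs_0: "row_pairs a b c d f 0 = close_row_pairs a b c d f 0"
  and row_pairs_1: "row_pairs a b c d f (Suc 0) = close_row_pairs a b c d f (Suc 0)"
  by (simp_all add: row_pairs_def pair_weight_def algebra_simps)

text \<open>A pair with \<open>x - y \<ge> 2\<close> loses the last two boxes of its first row, one
  \<open>a\<close> and one \<open>b\<close>, and becomes an arbitrary pair with first entry at most
  \<open>K\<close>.\<close>

lemma row_pairs_Suc_Suc:
  "row_pairs a b c d f (Suc (Suc K)) =
     close_row_pairs a b c d f (Suc (Suc K)) + a * b * row_pairs a b c d f K"
proof (induction K)
  case 0
  show ?case
    by (simp add: row_pairs_def pair_weight_def algebra_simps)
next
  case (Suc K)
  have "(\<Sum>y\<le>Suc (Suc (Suc K)). pair_weight a b c d (Suc (Suc (Suc K))) y * f y) =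
      pair_weight a b c d (Suc (Suc (Suc K))) (Suc (Suc (Suc K))) * f (Suc (Suc (Suc K))) +
      pair_weight a b c d (Suc (Suc (Suc K))) (Suc (Suc K)) * f (Suc (Suc K)) +
      a * b * (\<Sum>y\<le>Suc K. pair_weight a b c d (Suc K) y * f y)"
    by (simp add: pair_weight_add_left sum_distrib_left algebra_simps)
  then show ?case
    using row_pairs_Suc[of a b c d f "Suc (Suc K)"] row_pairs_Suc[of a b c d f K]
    by (simp add: Suc.IH algebra_simps del: sum.atMost_Suc)
qed

lemma close_row_pairs_sum:
  "close_row_pairs a b c d (\<lambda>K. \<Sum>j\<in>J. u j * f j K) K =
     (\<Sum>j\<in>J. u j * close_row_pairs a b c d (f j) K)"
  by (induction K) (simp_all add: sum.distrib sum_distrib_left algebra_simps)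

text \<open>The shifted function vanishes below \<open>2 * j\<close>, so only pairs with both
  entries at least \<open>2 * j\<close> contribute; subtract \<open>2 * j\<close> from both.\<close>

lemma close_row_pairs_shift:
  "close_row_pairs a b c d (\<lambda>K. if 2 * j \<le> K then f (K - 2 * j) else 0) K =
     (if 2 * j \<le> K then (a * b * c * d) ^ j * close_row_pairs a b c d f (K - 2 * j) else 0)"
proof (induction K)
  case 0
  show ?case by simp
next
  case (Suc K)
  consider "Suc K < 2 * j" | "Suc K = 2 * j" | k where "K = k + 2 * j"
    by (metis Suc_leI add.commute le_Suc_ex linorder_neqE_nat less_Suc_eq_le)
  then show ?case
  proof cases
    \<comment> \<open>The smallest contributing pair \<open>(2 * j, 2 * j)\<close> corresponds to
      the base value \<open>f 0\<close>.\<close>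
    case 2
    have "pair_weight a b c d (2 * j) (2 * j) = (a * b * c * d) ^ j"
      using pair_weight_add_both[of a b c d 0 j 0] by (simp add: pair_weight_def)
    then show ?thesis unfolding close_row_pairs.simps using Suc.IH 2 by simp
  next
    case 3
    have "pair_weight a b c d (Suc K) (Suc K) = (a * b * c * d) ^ j * pair_weight a b c d (Suc k) (Suc k)"
      "pair_weight a b c d (Suc K) K = (a * b * c * d) ^ j * pair_weight a b c d (Suc k) k"
      using pair_weight_add_both[of a b c d "Suc k" j "Suc k"]
        pair_weight_add_both[of a b c d "Suc k" j k] 3 by simp_all
    moreover have "Suc K - 2 * j = Suc k" "K - 2 * j = k" using 3 by simp_all
    ultimately show ?thesis using Suc.IH 3 by (simp add: algebra_simps)
  qed (use Suc.IH in simp)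
qed

text \<open>\<open>qhomog q L n\<close> is the complete homogeneous symmetric polynomial of degree \<open>n\<close> in
  \<open>1, q, \<dots>, q ^ (L - 1)\<close>, that is, a Gaussian binomial coefficient without denominators.\<close>

fun qhomog :: "'a::comm_ring_1 \<Rightarrow> nat \<Rightarrow> nat \<Rightarrow> 'a" where
  "qhomog q 0 n = (if n = 0 then 1 else 0)"
| "qhomog q (Suc L) 0 = 1"
| "qhomog q (Suc L) (Suc n) = q ^ Suc n * qhomog q L (Suc n) + qhomog q (Suc L) n"

lemma qhomog_0_right [simp]: "qhomog q L 0 = 1"
  by (cases L) simp_all

text \<open>The identity holds because \<^const>\<open>close_row_pairs\<close> commutes with the shift of \<open>K\<close> by 2 up
  to the factor \<open>Q\<close> (\<open>close_row_pairs_shift\<close>).\<close>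

lemma Phi_eq_sum_close_gf:
  "Phi K (2 * M) a b c d =
     (\<Sum>j\<le>K div 2. qhomog (a * b * c * d) M j * (a * b) ^ j * close_gf a b c d M (K - 2 * j))"
proof (induction M arbitrary: K)
  case 0
  have "(\<Sum>j\<le>n. (if j = 0 then 1 else 0) * (a * b) ^ j * 1) = (1::'a)" for n
    by (induction n) auto
  then show ?case by (simp add: Phi_0_right)
next
  case (Suc M)
  let ?Q = "a * b * c * d" and ?T = "close_row_pairs a b c d"
  define P where "P K = Phi K (2 * M) a b c d" for K
  define G where "G = close_gf a b c d (Suc M)"
  have T: "?T P K = (\<Sum>j\<le>K div 2. ?Q ^ j * qhomog ?Q M j * (a * b) ^ j * G (K - 2 * j))" for K
  proof -
    \<comment> \<open>Linearity needs a range of \<open>j\<close> independent of \<open>k\<close>.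
      The range up to \<open>K\<close> suffices, since by \<open>loc\<close> the value at
      \<open>K\<close> depends only on arguments up to \<open>K\<close>.\<close>
    have cut: "(\<Sum>j\<le>k div 2. F j) = (\<Sum>j\<le>J. if 2 * j \<le> k then F j else 0)"
      if "k \<le> J" for k J and F :: "nat \<Rightarrow> 'a"
      by (rule sum.mono_neutral_cong_left) (use that in auto)
    have loc: "?T f k = ?T f' k" if "\<And>i. i \<le> k \<Longrightarrow> f i = f' i" for f f' k
      using that by (induction k) auto
    have "?T P K = ?T (\<lambda>k. \<Sum>j\<le>K. qhomog ?Q M j * (a * b) ^ j *
        (if 2 * j \<le> k then close_gf a b c d M (k - 2 * j) else 0)) K"
      by (rule loc) (auto simp: P_def Suc.IH cut intro!: sum.cong)
    also have "\<dots> = (\<Sum>j\<le>K. qhomog ?Q M j * (a * b) ^ j *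
        (if 2 * j \<le> K then ?Q ^ j * G (K - 2 * j) else 0))"
      by (simp only: close_row_pairs_sum close_row_pairs_shift G_def close_gf_Suc)
    also have "\<dots> = (\<Sum>j\<le>K div 2. ?Q ^ j * qhomog ?Q M j * (a * b) ^ j * G (K - 2 * j))"
      by (subst cut[of K K]) (auto intro!: sum.cong)
    finally show ?thesis .
  qed
  have "row_pairs a b c d P K =
      (\<Sum>j\<le>K div 2. qhomog ?Q (Suc M) j * (a * b) ^ j * G (K - 2 * j))" for K
  proof (induction K rule: induct_nat_012)
    case 0
    show ?case using T[of 0] by (simp add: row_pairs_0)
  next
    case 1
    show ?case using T[of "Suc 0"] by (simp add: row_pairs_1)
  next
    case (ge2 K)
    \<comment> \<open>Expand \<open>qhomog ?Q (Suc M) (Suc j)\<close> by its recurrence: the first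
      summands, with the term of index 0, form \<open>?T P\<close>; the second give the sum for
      \<open>K\<close> times \<open>a * b\<close>.\<close>
    have "(\<Sum>j\<le>Suc (Suc K) div 2. qhomog ?Q (Suc M) j * (a * b) ^ j * G (Suc (Suc K) - 2 * j)) =
        ?T P (Suc (Suc K)) +
        a * b * (\<Sum>j\<le>K div 2. qhomog ?Q (Suc M) j * (a * b) ^ j * G (K - 2 * j))"
      by (simp add: T[of "Suc (Suc K)"] sum.atMost_Suc_shift sum_distrib_left sum.distrib algebra_simps
        del: sum.atMost_Suc close_row_pairs.simps)
    then show ?case by (simp only: row_pairs_Suc_Suc ge2)
  qed
  then show ?case
    by (simp add: Phi_split_first_rows row_pairs_def P_def G_def)
qed

subsection \<open>Generating functions in the number of row pairs\<close>

text \<open>The shifted factorial (-xz; q)_L with z = \<open>fps_X\<close>; the exponent of z will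
  count row pairs.\<close>

definition fps_prod :: "'a::comm_ring_1 \<Rightarrow> 'a \<Rightarrow> nat \<Rightarrow> 'a fps" where
  "fps_prod q x L = (\<Prod>t<L. 1 + fps_const (x * q ^ t) * fps_X)"

lemma fps_nth_linear_mult:
  fixes x :: "'a::comm_ring_1"
  shows "fps_nth ((1 + fps_const x * fps_X) * f) n =
     fps_nth f n + (if n = 0 then 0 else x * fps_nth f (n - 1))"
  by (simp add: distrib_right mult.assoc)

section \<open>Shifted factorials and Gaussian binomials\<close>

lemma qpoch_Suc: "qpoch x q (Suc n) = qpoch x q n * (1 - x * q ^ n)"
  by (simp add: qpoch_def)

lemma qpoch_Suc_shift: "qpoch x q (Suc n) = (1 - x) * qpoch (x * q) q n"
  by (simp add: qpoch_def prod.lessThan_Suc_shift mult_ac del: prod.lessThan_Suc)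

text \<open>Both sides obey the recurrence of \<open>qhomog\<close>, because q^(n+1) (1 - q^L) + (1
  - q^(n+1)) = 1 - q^(L+n+1).\<close>

lemma qpoch_power_eq: "qpoch (q ^ L) q n = qhomog q L n * qpoch q q n"
proof (induction q L n rule: qhomog.induct)
  case (1 q n)
  then show ?case by (cases n) (simp_all add: qpoch_Suc_shift, simp add: qpoch_def)
next
  case (2 q L)
  then show ?case by (simp add: qpoch_def)
next
  case (3 q L n)
  have "qhomog q (Suc L) (Suc n) * qpoch q q (Suc n) =
      q ^ Suc n * (qhomog q L (Suc n) * qpoch q q (Suc n)) +
      qhomog q (Suc L) n * qpoch q q n * (1 - q ^ Suc n)"
    by (simp add: qpoch_Suc algebra_simps)
  also have "\<dots> = q ^ Suc n * qpoch (q ^ L) q (Suc n) + qpoch (q ^ Suc L) q n * (1 - q ^ Suc n)"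
    by (simp only: 3)
  also have "qpoch (q ^ L) q (Suc n) = (1 - q ^ L) * qpoch (q ^ Suc L) q n"
    by (simp add: qpoch_Suc_shift mult.commute)
  finally show ?case
    by (simp add: qpoch_Suc algebra_simps power_add)
qed

lemma qpoch_add: "qpoch q q (L + n) = qpoch q q L * qpoch (q ^ Suc L) q n"
  by (induction n) (simp_all add: qpoch_Suc power_add mult_ac, simp add: qpoch_def)

lemma qpoch_nonzero:
  fixes q :: "'a::field"
  assumes "\<And>k. 1 \<le> k \<Longrightarrow> k \<le> n \<Longrightarrow> q ^ k \<noteq> 1"
  shows "qpoch q q n \<noteq> 0"
  using assms[of "Suc k" for k] by (auto simp: qpoch_def)

text \<open>Cancelling (q; q)_L leaves (q^(L+1); q)_n / (q; q)_n.\<close>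

lemma qbinom_add_eq_qhomog:
  assumes "qpoch q q L \<noteq> 0" "qpoch q q n \<noteq> 0"
  shows "qbinom q (L + n) n = qhomog q (Suc L) n"
  using assms by (simp add: qbinom_def qpoch_add qpoch_power_eq del: power_Suc)

text \<open>The q-Pascal rule. For \<open>m < L\<close> it reduces to the splitting
  \<open>uv\<close> of 1 - q^(L+1); for \<open>m = L\<close> the first term is the default
  0.\<close>

lemma qbinom_Suc_Suc:
  fixes q :: "'a::field"
  assumes "\<And>k. 1 \<le> k \<Longrightarrow> k \<le> Suc L \<Longrightarrow> q ^ k \<noteq> 1" and "m \<le> L"
  shows "qbinom q (Suc L) (Suc m) = qbinom q L (Suc m) + q ^ (L - m) * qbinom q L m"
proof (cases "m = L")
  case True
  have "qpoch q q L \<noteq> 0" "qpoch q q (Suc L) \<noteq> 0"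
    by (rule qpoch_nonzero, use assms in simp)+
  then show ?thesis using True by (simp add: qbinom_def qpoch_def)
next
  case False
  define k where "k = L - Suc m"
  have L: "L = Suc (m + k)" using False assms(2) by (simp add: k_def)
  have nz: "qpoch q q (Suc m) \<noteq> 0" "qpoch q q (Suc k) \<noteq> 0"
    by (rule qpoch_nonzero, use assms L in simp)+
  define u where "u = 1 - q * q ^ m"
  define v where "v = 1 - q * q ^ k"
  have um: "qpoch q q (Suc m) = qpoch q q m * u" and vk: "qpoch q q (Suc k) = qpoch q q k * v"
    by (simp_all add: u_def v_def qpoch_Suc)
  have uv: "qpoch q q (Suc L) = qpoch q q L * (v + q ^ Suc k * u)"
    unfolding L qpoch_Suc[of q q "Suc (m + k)"] by (simp add: u_def v_def algebra_simps power_add)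
  have le: "Suc m \<le> L" using L by simp
  have "Suc L - Suc m = Suc k" "L - Suc m = k" "L - m = Suc k"
    using L by simp_all
  then have "qbinom q (Suc L) (Suc m) =
        qpoch q q L * (v + q ^ Suc k * u) / (qpoch q q m * u * (qpoch q q k * v))"
    and "qbinom q L (Suc m) = qpoch q q L / (qpoch q q m * u * qpoch q q k)"
    and "qbinom q L m = qpoch q q L / (qpoch q q m * (qpoch q q k * v))"
    and "q ^ (L - m) = q ^ Suc k"
    using assms(2) le by (simp_all add: qbinom_def um vk uv del: power_Suc)
  moreover have "P * (v + s * u) / (A * u * (B * v)) = P / (A * u * B) + s * (P / (A * (B * v)))"
    if "A * u \<noteq> 0" "B * v \<noteq> 0" for A B P s :: 'a
    using that by (simp add: field_simps)
  ultimately show ?thesis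
    using nz by (simp only: um vk)
qed

text \<open>The finite q-binomial theorem: splitting off the last factor turns the induction step
  into the q-Pascal rule.\<close>

lemma fps_nth_fps_prod:
  assumes "\<And>k. 1 \<le> k \<Longrightarrow> k \<le> L \<Longrightarrow> q ^ k \<noteq> 1"
  shows "fps_nth (fps_prod q x L) m = x ^ m * q ^ (m choose 2) * qbinom q L m"
  using assms
proof (induction L arbitrary: m)
  case 0
  then show ?case by (simp add: fps_prod_def qbinom_def qpoch_def binomial_eq_0)
next
  case (Suc L)
  have IH: "fps_nth (fps_prod q x L) m = x ^ m * q ^ (m choose 2) * qbinom q L m" for m
    by (rule Suc.IH) (use Suc.prems in simp)
  have rec: "fps_nth (fps_prod q x (Suc L)) m =
      fps_nth (fps_prod q x L) m + (if m = 0 then 0 else x * q ^ L * fps_nth (fps_prod q x L) (m - 1))" for m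
    by (simp only: fps_prod_def prod.lessThan_Suc mult.commute[of "prod _ _"] fps_nth_linear_mult)
  have nz: "qpoch q q L \<noteq> 0" "qpoch q q (Suc L) \<noteq> 0"
    by (rule qpoch_nonzero, use Suc.prems in simp)+
  show ?case
  proof (cases m)
    case 0
    then show ?thesis using nz by (simp add: rec IH qbinom_def binomial_eq_0)
  next
    case m: (Suc k)
    show ?thesis
    proof (cases "k \<le> L")
      case True
      have choose: "q ^ (Suc k choose 2) = q ^ k * q ^ (k choose 2)"
        by (simp add: numeral_2_eq_2 power_add)
      have qL: "q ^ L = q ^ k * q ^ (L - k)"
        using True by (simp flip: power_add)
      have "fps_nth (fps_prod q x (Suc L)) (Suc k) =
          x ^ Suc k * q ^ (Suc k choose 2) * qbinom q L (Suc k) +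
          x * q ^ L * (x ^ k * q ^ (k choose 2) * qbinom q L k)"
        by (simp only: rec IH) simp
      also have "\<dots> = x ^ Suc k * q ^ (Suc k choose 2) *
          (qbinom q L (Suc k) + q ^ (L - k) * qbinom q L k)"
        by (simp only: choose qL power_Suc distrib_left) (simp only: mult_ac)
      also have "qbinom q L (Suc k) + q ^ (L - k) * qbinom q L k = qbinom q (Suc L) (Suc k)"
        by (rule qbinom_Suc_Suc[symmetric]) (use Suc.prems True in simp_all)
      finally show ?thesis by (simp only: m)
    next
      case False
      then show ?thesis by (simp add: m rec IH qbinom_def)
    qed
  qed
qed

text \<open>The generating function of complete homogeneous polynomials inverts the product.
  Removing the factor 1 - xz and replacing \<open>x\<close> by \<open>x * q\<close> matches the
  recurrence of \<open>qhomog\<close>.\<close>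

lemma fps_prod_qhomog: "fps_prod q (- x) L * Abs_fps (\<lambda>n. x ^ n * qhomog q L n) = 1"
proof (induction L arbitrary: x)
  case 0
  show ?case by (rule fps_ext) (simp add: fps_prod_def)
next
  case (Suc L)
  have "fps_prod q (- x) (Suc L) = fps_prod q (- (x * q)) L * (1 + fps_const (- x) * fps_X)"
    by (simp add: fps_prod_def prod.lessThan_Suc_shift mult_ac del: prod.lessThan_Suc)
  moreover have "(1 + fps_const (- x) * fps_X) * Abs_fps (\<lambda>n. x ^ n * qhomog q (Suc L) n) =
      Abs_fps (\<lambda>n. (x * q) ^ n * qhomog q L n)"
  proof (rule fps_ext)
    fix n show "fps_nth ((1 + fps_const (- x) * fps_X) * Abs_fps (\<lambda>n. x ^ n * qhomog q (Suc L) n)) n =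
        fps_nth (Abs_fps (\<lambda>n. (x * q) ^ n * qhomog q L n)) n"
      unfolding fps_nth_linear_mult by (cases n) (simp_all add: algebra_simps power_mult_distrib)
  qed
  ultimately show ?case
    using Suc.IH[of "x * q"] by (simp add: mult.assoc)
qed

section \<open>Product formula for chains of close row pairs\<close>

text \<open>Raising the bound to \<open>Suc K\<close> admits the pair \<open>(Suc K, Suc K)\<close>,
  which may repeat and gives a geometric factor, and \<open>(Suc K, K)\<close>, which occurs at most
  once.\<close>

lemma close_gf_fps_Suc:
  "(1 + fps_const (- pair_weight a b c d (Suc K) (Suc K)) * fps_X) * Abs_fps (\<lambda>M. close_gf a b c d M (Suc K)) =
   (1 + fps_const (pair_weight a b c d (Suc K) K) * fps_X) * Abs_fps (\<lambda>M. close_gf a b c d M K)"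
proof (rule fps_ext)
  fix n
  show "fps_nth ((1 + fps_const (- pair_weight a b c d (Suc K) (Suc K)) * fps_X) *
      Abs_fps (\<lambda>M. close_gf a b c d M (Suc K))) n =
    fps_nth ((1 + fps_const (pair_weight a b c d (Suc K) K) * fps_X) *
      Abs_fps (\<lambda>M. close_gf a b c d M K)) n"
    unfolding fps_nth_linear_mult by (cases n) (simp_all add: close_gf_Suc)
qed

lemma close_gf_fps_prod:
  fixes a b c d :: "'a::comm_ring_1"
  defines "Q \<equiv> a * b * c * d"
  assumes "\<nu> \<in> {0, 1}"
  shows "fps_prod Q (- 1) (Suc l) * fps_prod Q (- (a * c)) (l + \<nu>) *
      Abs_fps (\<lambda>M. close_gf a b c d M (2 * l + \<nu>)) =
    fps_prod Q a (l + \<nu>) * fps_prod Q (a * b * c) l"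
proof -
  let ?g = "\<lambda>K. Abs_fps (\<lambda>M. close_gf a b c d M K)"
  \<comment> \<open>The pairs \<open>(0, 0)\<close>, \<open>(1, 1)\<close>, \<open>(1, 0)\<close>
    and \<open>(2, 1)\<close>, each widened by \<open>2 * l\<close> columns.\<close>
  have w: "pair_weight a b c d (2 * l) (2 * l) = Q ^ l"
    "pair_weight a b c d (Suc (2 * l)) (Suc (2 * l)) = a * c * Q ^ l"
    "pair_weight a b c d (Suc (2 * l)) (2 * l) = a * Q ^ l"
    "pair_weight a b c d (Suc (Suc (2 * l))) (Suc (2 * l)) = a * b * c * Q ^ l" for l
    using pair_weight_add_both[of a b c d 0 l 0] pair_weight_add_both[of a b c d 1 l 0]
      pair_weight_add_both[of a b c d 1 l 1] pair_weight_add_both[of a b c d 2 l 1]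
    by (simp_all add: Q_def pair_weight_def)
  have S: "fps_prod Q x (Suc L) = (1 + fps_const (x * Q ^ L) * fps_X) * fps_prod Q x L" for x L
    by (simp add: fps_prod_def mult.commute)
  have odd: "fps_prod Q (- 1) (Suc l) * fps_prod Q (- (a * c)) (Suc l) * ?g (Suc (2 * l)) =
      fps_prod Q a (Suc l) * fps_prod Q (a * b * c) l"
    if "fps_prod Q (- 1) (Suc l) * fps_prod Q (- (a * c)) l * ?g (2 * l) =
      fps_prod Q a l * fps_prod Q (a * b * c) l" for l
  proof -
    have "fps_prod Q (- 1) (Suc l) * fps_prod Q (- (a * c)) (Suc l) * ?g (Suc (2 * l)) =
        fps_prod Q (- 1) (Suc l) * fps_prod Q (- (a * c)) l *
        ((1 + fps_const (- (a * c * Q ^ l)) * fps_X) * ?g (Suc (2 * l)))"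
      by (simp only: S[of "- (a * c)"] mult_minus_left) (simp only: mult_ac)
    also have "\<dots> = (1 + fps_const (a * Q ^ l) * fps_X) *
        (fps_prod Q (- 1) (Suc l) * fps_prod Q (- (a * c)) l * ?g (2 * l))"
      by (simp only: close_gf_fps_Suc[of a b c d "2 * l", unfolded w]) (simp only: mult_ac)
    also have "\<dots> = fps_prod Q a (Suc l) * fps_prod Q (a * b * c) l"
      by (simp only: that S[of a]) (simp only: mult_ac)
    finally show ?thesis .
  qed
  have even: "fps_prod Q (- 1) (Suc l) * fps_prod Q (- (a * c)) l * ?g (2 * l) =
      fps_prod Q a l * fps_prod Q (a * b * c) l" for l
  proof (induction l)
    case 0
    show ?case
    proof (rule fps_ext)
      fix n
      \<comment> \<open>At bound 0 every pair is \<open>(0, 0)\<close> and the series is geometric;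
        this accounts for the extra factor in \<open>Suc l\<close>.\<close>
      have "fps_nth ((1 + fps_const (- 1) * fps_X) * ?g 0) n = fps_nth 1 n"
        unfolding fps_nth_linear_mult by simp
      then show "fps_nth (fps_prod Q (- 1) (Suc 0) * fps_prod Q (- (a * c)) 0 * ?g (2 * 0)) n =
          fps_nth (fps_prod Q a 0 * fps_prod Q (a * b * c) 0) n"
        by (simp add: fps_prod_def)
    qed
  next
    case (Suc l)
    have "fps_prod Q (- 1) (Suc (Suc l)) * fps_prod Q (- (a * c)) (Suc l) * ?g (2 * Suc l) =
        fps_prod Q (- 1) (Suc l) * fps_prod Q (- (a * c)) (Suc l) *
        ((1 + fps_const (- (Q ^ Suc l)) * fps_X) * ?g (2 * Suc l))"
      by (simp only: S[of "- 1"] mult_minus_left mult_1) (simp only: mult_ac)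
    also have "(1 + fps_const (- (Q ^ Suc l)) * fps_X) * ?g (2 * Suc l) =
        (1 + fps_const (a * b * c * Q ^ l) * fps_X) * ?g (Suc (2 * l))"
      using close_gf_fps_Suc[of a b c d "Suc (2 * l)"] w(1)[of "Suc l"] w(4)[of l] by simp
    also have "fps_prod Q (- 1) (Suc l) * fps_prod Q (- (a * c)) (Suc l) * \<dots> =
        (1 + fps_const (a * b * c * Q ^ l) * fps_X) *
        (fps_prod Q (- 1) (Suc l) * fps_prod Q (- (a * c)) (Suc l) * ?g (Suc (2 * l)))"
      by (simp only: mult_ac)
    also have "\<dots> = fps_prod Q a (Suc l) * fps_prod Q (a * b * c) (Suc l)"
      by (simp only: odd[OF Suc.IH] S[of "a * b * c"]) (simp only: mult_ac)
    finally show ?case .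
  qed
  show ?thesis
    using assms(2) even[of l] odd[OF even[of l]] by auto
qed

text \<open>Multiply by the inverse series. The nesting of the factors follows the order of the sums
  over \<open>m\<^sub>2\<close>, \<open>m\<^sub>1\<close> and \<open>n\<close>.\<close>

lemma close_gf_fps:
  fixes a b c d :: "'a::comm_ring_1"
  defines "Q \<equiv> a * b * c * d"
  assumes "\<nu> \<in> {0, 1}"
  shows "Abs_fps (\<lambda>M. close_gf a b c d M (2 * l + \<nu>)) =
    fps_prod Q (a * b * c) l * (fps_prod Q a (l + \<nu>) *
      (Abs_fps (\<lambda>n. (a * c) ^ n * qhomog Q (l + \<nu>) n) * Abs_fps (qhomog Q (Suc l))))"
proof -
  let ?G = "Abs_fps (\<lambda>M. close_gf a b c d M (2 * l + \<nu>))"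
  let ?D = "Abs_fps (\<lambda>n. (a * c) ^ n * qhomog Q (l + \<nu>) n)" and ?C = "Abs_fps (qhomog Q (Suc l))"
  have "fps_prod Q (- (a * c)) (l + \<nu>) * ?D = 1" "fps_prod Q (- 1) (Suc l) * ?C = 1"
    using fps_prod_qhomog[of Q "a * c" "l + \<nu>"] fps_prod_qhomog[of Q 1 "Suc l"] by simp_all
  then have "?G = (fps_prod Q (- (a * c)) (l + \<nu>) * ?D) * (fps_prod Q (- 1) (Suc l) * ?C) * ?G"
    by simp
  also have "\<dots> = (fps_prod Q (- 1) (Suc l) * fps_prod Q (- (a * c)) (l + \<nu>) * ?G) * (?D * ?C)"
    by (simp only: mult_ac)
  also have "\<dots> = fps_prod Q a (l + \<nu>) * fps_prod Q (a * b * c) l * (?D * ?C)"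
    using close_gf_fps_prod[OF assms(2), of a b c d l] by (simp only: Q_def)
  finally show ?thesis by (simp only: mult_ac)
qed

text \<open>Lets the summation range depend on the degree bound of \<open>f\<close> instead of
  \<open>M\<close>, as in the sums over \<open>m\<^sub>1\<close> and
  \<open>m\<^sub>2\<close>.\<close>

lemma fps_mult_nth_bounded:
  fixes f g :: "'a::comm_ring_1 fps"
  assumes "\<And>m. L < m \<Longrightarrow> fps_nth f m = 0"
  shows "fps_nth (f * g) M = (\<Sum>m=0..L. fps_nth f m * (if m \<le> M then fps_nth g (M - m) else 0))"
proof -
  have "fps_nth (f * g) M = (\<Sum>m=0..max L M. fps_nth f m * (if m \<le> M then fps_nth g (M - m) else 0))"
    unfolding fps_mult_nth by (rule sum.mono_neutral_cong_left) auto
  also have "\<dots> = (\<Sum>m=0..L. fps_nth f m * (if m \<le> M then fps_nth g (M - m) else 0))"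
    by (rule sum.mono_neutral_right) (use assms in auto)
  finally show ?thesis .
qed

lemma close_gf_eq_sum:
  fixes a b c d Q :: "'a::field"
  assumes "\<nu> \<in> {0, 1}" and Q: "Q = a * b * c * d"
    and nonzero: "\<And>k. 1 \<le> k \<Longrightarrow> k \<le> max (l + \<nu>) M \<Longrightarrow> Q ^ k \<noteq> 1"
  shows "close_gf a b c d M (2 * l + \<nu>) =
      (\<Sum>m\<^sub>2=0..l. (a * b * c) ^ m\<^sub>2 * Q ^ (m\<^sub>2 choose 2) * qbinom Q l m\<^sub>2 *
        (\<Sum>m\<^sub>1=0..l + \<nu>. a ^ m\<^sub>1 * Q ^ (m\<^sub>1 choose 2) * qbinom Q (l + \<nu>) m\<^sub>1 *
          (if m\<^sub>1 + m\<^sub>2 \<le> M then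
             (\<Sum>n=0..M - m\<^sub>1 - m\<^sub>2.
                qbinom Q (M + l - n - m\<^sub>1 - m\<^sub>2) (M - n - m\<^sub>1 - m\<^sub>2) *
                (qpoch (Q ^ (l + \<nu>)) Q n / qpoch Q Q n) * (a * c) ^ n)
           else 0)))"
proof -
  let ?H = "Abs_fps (\<lambda>n. (a * c) ^ n * qhomog Q (l + \<nu>) n) * Abs_fps (qhomog Q (Suc l))"
  have nz: "qpoch Q Q k \<noteq> 0" if "k \<le> max (l + \<nu>) M" for k
    by (rule qpoch_nonzero) (use that nonzero in simp)
  have A: "fps_nth (fps_prod Q a (l + \<nu>)) m = a ^ m * Q ^ (m choose 2) * qbinom Q (l + \<nu>) m"
    and B: "fps_nth (fps_prod Q (a * b * c) l) m = (a * b * c) ^ m * Q ^ (m choose 2) * qbinom Q l m" for m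
    by (rule fps_nth_fps_prod, use nonzero in simp)+
  have H: "fps_nth ?H (M - m\<^sub>1 - m\<^sub>2) = (\<Sum>n=0..M - m\<^sub>1 - m\<^sub>2.
      qbinom Q (M + l - n - m\<^sub>1 - m\<^sub>2) (M - n - m\<^sub>1 - m\<^sub>2) *
      (qpoch (Q ^ (l + \<nu>)) Q n / qpoch Q Q n) * (a * c) ^ n)"
    if "m\<^sub>1 + m\<^sub>2 \<le> M" for m\<^sub>1 m\<^sub>2
    unfolding fps_mult_nth
  proof (rule sum.cong[OF refl])
    fix n assume n: "n \<in> {0..M - m\<^sub>1 - m\<^sub>2}"
    let ?k = "M - n - m\<^sub>1 - m\<^sub>2"
    \<comment> \<open>The truncated subtractions are exact here, because
      \<open>n + m\<^sub>1 + m\<^sub>2 \<le> M\<close>.\<close>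
    have k: "M + l - n - m\<^sub>1 - m\<^sub>2 = l + ?k" "M - m\<^sub>1 - m\<^sub>2 - n = ?k"
      using n that by auto
    have "qbinom Q (l + ?k) ?k = qhomog Q (Suc l) ?k"
      by (rule qbinom_add_eq_qhomog; rule nz; simp)
    moreover have "qpoch (Q ^ (l + \<nu>)) Q n / qpoch Q Q n = qhomog Q (l + \<nu>) n"
      using nz[of n] n by (simp add: qpoch_power_eq)
    ultimately show "fps_nth (Abs_fps (\<lambda>n. (a * c) ^ n * qhomog Q (l + \<nu>) n)) n *
        fps_nth (Abs_fps (qhomog Q (Suc l))) (M - m\<^sub>1 - m\<^sub>2 - n) =
      qbinom Q (M + l - n - m\<^sub>1 - m\<^sub>2) ?k * (qpoch (Q ^ (l + \<nu>)) Q n / qpoch Q Q n) * (a * c) ^ n"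
      unfolding k by simp
  qed
  have "close_gf a b c d M (2 * l + \<nu>) =
      fps_nth (fps_prod Q (a * b * c) l * (fps_prod Q a (l + \<nu>) * ?H)) M"
    using arg_cong[OF close_gf_fps[OF assms(1), of a b c d l], of "\<lambda>f. fps_nth f M"]
    by (simp only: Q fps_nth_Abs_fps)
  also have "\<dots> = (\<Sum>m\<^sub>2=0..l. (a * b * c) ^ m\<^sub>2 * Q ^ (m\<^sub>2 choose 2) * qbinom Q l m\<^sub>2 *
      (if m\<^sub>2 \<le> M then fps_nth (fps_prod Q a (l + \<nu>) * ?H) (M - m\<^sub>2) else 0))"
    by (subst fps_mult_nth_bounded[where L = l]) (simp_all only: B, simp add: qbinom_def)
  also have "\<dots> = (\<Sum>m\<^sub>2=0..l. (a * b * c) ^ m\<^sub>2 * Q ^ (m\<^sub>2 choose 2) * qbinom Q l m\<^sub>2 *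
      (\<Sum>m\<^sub>1=0..l + \<nu>. a ^ m\<^sub>1 * Q ^ (m\<^sub>1 choose 2) * qbinom Q (l + \<nu>) m\<^sub>1 *
        (if m\<^sub>1 + m\<^sub>2 \<le> M then fps_nth ?H (M - m\<^sub>1 - m\<^sub>2) else 0)))"
  proof (rule sum.cong[OF refl], rule arg_cong[where f = "(*) x" for x])
    fix m\<^sub>2
    have z: "fps_nth (fps_prod Q a (l + \<nu>)) m = 0" if "l + \<nu> < m" for m
      using that by (simp add: A qbinom_def)
    show "(if m\<^sub>2 \<le> M then fps_nth (fps_prod Q a (l + \<nu>) * ?H) (M - m\<^sub>2) else 0) =
      (\<Sum>m\<^sub>1=0..l + \<nu>. a ^ m\<^sub>1 * Q ^ (m\<^sub>1 choose 2) * qbinom Q (l + \<nu>) m\<^sub>1 *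
        (if m\<^sub>1 + m\<^sub>2 \<le> M then fps_nth ?H (M - m\<^sub>1 - m\<^sub>2) else 0))"
    proof (cases "m\<^sub>2 \<le> M")
      case True
      have "fps_nth (fps_prod Q a (l + \<nu>) * ?H) (M - m\<^sub>2) =
          (\<Sum>m\<^sub>1=0..l + \<nu>. fps_nth (fps_prod Q a (l + \<nu>)) m\<^sub>1 *
            (if m\<^sub>1 \<le> M - m\<^sub>2 then fps_nth ?H (M - m\<^sub>2 - m\<^sub>1) else 0))"
        by (rule fps_mult_nth_bounded) (rule z)
      with True show ?thesis
        unfolding A by (auto intro!: sum.cong simp: le_diff_conv2 add.commute)
    qed simp
  qed
  finally have eq: "close_gf a b c d M (2 * l + \<nu>) = \<dots>" .
  have H': "(if m\<^sub>1 + m\<^sub>2 \<le> M then fps_nth ?H (M - m\<^sub>1 - m\<^sub>2) else 0) =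
      (if m\<^sub>1 + m\<^sub>2 \<le> M then
         (\<Sum>n=0..M - m\<^sub>1 - m\<^sub>2.
            qbinom Q (M + l - n - m\<^sub>1 - m\<^sub>2) (M - n - m\<^sub>1 - m\<^sub>2) *
            (qpoch (Q ^ (l + \<nu>)) Q n / qpoch Q Q n) * (a * c) ^ n)
       else 0)" for m\<^sub>1 m\<^sub>2
    by (rule if_cong[OF refl H refl])
  from eq show ?thesis by (simp only: H')
qed

(* The variables range over an arbitrary field; four indeterminates are the case of a field of
   rational functions. The hypothesis nonzero says that no denominator on the right-hand side
   vanishes; it holds automatically for indeterminates. *)
theorem theorem6p2:
  fixes a b c d Q :: "'a::field" and N M \<nu> :: nat
  assumes nu: "\<nu> \<in> {0, 1}"
    and pos: "0 < 2 * N + \<nu>" "0 < M"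
    and Q: "Q = a * b * c * d"
    and nonzero: "\<And>k. 1 \<le> k \<Longrightarrow> k \<le> max (N + \<nu>) M \<Longrightarrow> Q ^ k \<noteq> 1"
  shows "Phi (2 * N + \<nu>) (2 * M) a b c d =
    (\<Sum>l=0..N. qbinom Q (N - l + M - 1) (N - l) * (a * b) ^ (N - l) *
      (\<Sum>m\<^sub>2=0..l. (a * b * c) ^ m\<^sub>2 * Q ^ (m\<^sub>2 choose 2) * qbinom Q l m\<^sub>2 *
        (\<Sum>m\<^sub>1=0..l + \<nu>. a ^ m\<^sub>1 * Q ^ (m\<^sub>1 choose 2) * qbinom Q (l + \<nu>) m\<^sub>1 *
          (if m\<^sub>1 + m\<^sub>2 \<le> M then
             (\<Sum>n=0..M - m\<^sub>1 - m\<^sub>2.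
                qbinom Q (M + l - n - m\<^sub>1 - m\<^sub>2) (M - n - m\<^sub>1 - m\<^sub>2) *
                (qpoch (Q ^ (l + \<nu>)) Q n / qpoch Q Q n) * (a * c) ^ n)
           else 0))))"
proof -
  have "(2 * N + \<nu>) div 2 = N" using nu by auto
  then have "Phi (2 * N + \<nu>) (2 * M) a b c d =
      (\<Sum>j\<le>N. qhomog Q M j * (a * b) ^ j * close_gf a b c d M (2 * N + \<nu> - 2 * j))"
    by (simp add: Phi_eq_sum_close_gf Q)
  \<comment> \<open>Removing \<open>j\<close> pairs of columns leaves the bound
    \<open>2 * l + \<nu>\<close> with \<open>l = N - j\<close>.\<close>
  also have "\<dots> = (\<Sum>l=0..N. qhomog Q M (N - l) * (a * b) ^ (N - l) * close_gf a b c d M (2 * l + \<nu>))"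
    by (rule sum.reindex_bij_witness[where i = "\<lambda>l. N - l" and j = "\<lambda>j. N - j"])
      (auto simp: diff_mult_distrib2)
  also have "\<dots> = (\<Sum>l=0..N. qbinom Q (N - l + M - 1) (N - l) * (a * b) ^ (N - l) * close_gf a b c d M (2 * l + \<nu>))"
  proof (rule sum.cong[OF refl])
    fix l
    \<comment> \<open>The \<open>M\<close> variables 1, ..., Q^(M-1) give upper index
      \<open>M - 1 + (N - l)\<close>; writing \<open>M\<close> as a successor uses
      \<open>0 < M\<close>.\<close>
    have "qbinom Q (M - 1 + (N - l)) (N - l) = qhomog Q (Suc (M - 1)) (N - l)"
      by (rule qbinom_add_eq_qhomog; rule qpoch_nonzero, rule nonzero) auto
    moreover have "N - l + M - 1 = M - 1 + (N - l)" "Suc (M - 1) = M" using pos by simp_all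
    ultimately show "qhomog Q M (N - l) * (a * b) ^ (N - l) * close_gf a b c d M (2 * l + \<nu>) =
        qbinom Q (N - l + M - 1) (N - l) * (a * b) ^ (N - l) * close_gf a b c d M (2 * l + \<nu>)"
      by simp
  qed
  finally have eq: "Phi (2 * N + \<nu>) (2 * M) a b c d = \<dots>" .
  show ?thesis
    unfolding eq
  proof (rule sum.cong[OF refl], rule arg_cong[where f = "(*) x" for x])
    fix l assume "l \<in> {0..N}"
    then have "Q ^ k \<noteq> 1" if "1 \<le> k" "k \<le> max (l + \<nu>) M" for k
      using that by (intro nonzero) auto
    then show "close_gf a b c d M (2 * l + \<nu>) =
      (\<Sum>m\<^sub>2=0..l. (a * b * c) ^ m\<^sub>2 * Q ^ (m\<^sub>2 choose 2) * qbinom Q l m\<^sub>2 *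
        (\<Sum>m\<^sub>1=0..l + \<nu>. a ^ m\<^sub>1 * Q ^ (m\<^sub>1 choose 2) * qbinom Q (l + \<nu>) m\<^sub>1 *
          (if m\<^sub>1 + m\<^sub>2 \<le> M then
             (\<Sum>n=0..M - m\<^sub>1 - m\<^sub>2.
                qbinom Q (M + l - n - m\<^sub>1 - m\<^sub>2) (M - n - m\<^sub>1 - m\<^sub>2) *
                (qpoch (Q ^ (l + \<nu>)) Q n / qpoch Q Q n) * (a * c) ^ n)
           else 0)))"
      by (rule close_gf_eq_sum[OF nu Q])
  qed
qed

end
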